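(* Let $(H;\langle\cdot,\cdot\rangle)$ be an inner product space over the real or complex number field $\mathbb{K}$, let $x_i\in H$ for $i\in\{1,\dots,n\}$, and let $k_{ij}>0$ for $1\le i<j\le n$ be such that $$0\le \|x_i\|\,\|x_j\|-\operatorname{Re}\langle x_i,x_j\rangle\le k_{ij}\qquad\text{for } 1\le i<j\le n.$$ Then $$\Big(\sum_{i=1}^n\|x_i\|\Big)^2\le\Big\|\sum_{i=1}^n x_i\Big\|^2+2\sum_{1\le i<j\le n}k_{ij}.$$ Equality holds in this last inequality if and only if $\|x_i\|\,\|x_j\|-\operatorname{Re}\langle x_i,x_j\rangle=k_{ij}$ for each $i,j$ with $1\le i<j\le n$.
   Context: $n$ is a positive integer and $\|\cdot\|$ is the norm induced by the inner product. *)

theory Defs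
  imports "HOL-Analysis.Inner_Product"
begin

text \<open>
  Types of this class are exactly the copies of the real or the complex number field: the map
  \<open>to_complex\<close> is a field isomorphism onto the subfield of the reals or onto all of the complex
  numbers, and it supplies the conjugation and the real part.
\<close>

class real_or_complex = field +
  fixes to_complex :: "'a \<Rightarrow> complex"
  assumes to_complex_one: "to_complex 1 = 1"
    and to_complex_add: "to_complex (a + b) = to_complex a + to_complex b"
    and to_complex_mult: "to_complex (a * b) = to_complex a * to_complex b"
    and to_complex_inj: "inj to_complex"
    and to_complex_range: "range to_complex = \<real> \<or> range to_complex = UNIV"

instantiation real :: real_or_complex
begin
definition to_complex_real :: "real \<Rightarrow> complex" where "to_complex_real = of_real"
instance
  by standard (auto simp: to_complex_real_def Reals_def inj_of_real)
end

instantiation complex :: real_or_complex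
begin
definition to_complex_complex :: "complex \<Rightarrow> complex" where "to_complex_complex = id"
instance
  by standard (auto simp: to_complex_complex_def)
end

text \<open>Inner products are linear in the first argument.\<close>

locale inner_product_space = vector_space scale
  for scale :: "'k::real_or_complex \<Rightarrow> 'a::ab_group_add \<Rightarrow> 'a" +
  fixes ip :: "'a \<Rightarrow> 'a \<Rightarrow> 'k"
  assumes ip_add_left: "ip (x + y) z = ip x z + ip y z"
    and ip_scale_left: "ip (scale a x) y = a * ip x y"
    and ip_commute: "to_complex (ip y x) = cnj (to_complex (ip x y))"
    and ip_ge_zero: "0 \<le> Re (to_complex (ip x x))"
    and ip_eq_zero_iff: "ip x x = 0 \<longleftrightarrow> x = 0"

definition ip_re :: "('a \<Rightarrow> 'a \<Rightarrow> 'k::real_or_complex) \<Rightarrow> 'a \<Rightarrow> 'a \<Rightarrow> real"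
  where "ip_re ip x y = Re (to_complex (ip x y))"

text \<open>By \<open>ip_commute\<close> the value \<open>ip x x\<close> is real, so taking its real part loses nothing.\<close>

definition ip_norm :: "('a \<Rightarrow> 'a \<Rightarrow> 'k::real_or_complex) \<Rightarrow> 'a \<Rightarrow> real"
  where "ip_norm ip x = sqrt (ip_re ip x x)"

lemma inner_product_space_real_inner:
  "inner_product_space (scaleR :: real \<Rightarrow> 'a \<Rightarrow> 'a) (inner :: 'a::real_inner \<Rightarrow> 'a \<Rightarrow> real)"
  by unfold_locales
    (auto simp: to_complex_real_def algebra_simps inner_add_left inner_commute)

lemma ip_norm_real_inner: "ip_norm inner (x :: 'a::real_inner) = norm x"
  by (simp add: ip_norm_def ip_re_def to_complex_real_def norm_eq_sqrt_inner)

lemma inner_product_space_complex: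
  "inner_product_space ((*) :: complex \<Rightarrow> complex \<Rightarrow> complex) (\<lambda>x y. x * cnj y)"
  by unfold_locales (auto simp: to_complex_complex_def algebra_simps)

end

theory Submission
  imports Defs
begin

text \<open>
  Expanding both squares bilinearly turns the difference
  \<open>(\<Sum>i. \<parallel>x i\<parallel>)\<^sup>2 - \<parallel>\<Sum>i. x i\<parallel>\<^sup>2\<close> into the double sum over all \<open>i\<close>, \<open>j\<close> of the defects
  \<open>\<parallel>x i\<parallel> \<parallel>x j\<parallel> - Re \<langle>x i, x j\<rangle>\<close>. The defect is symmetric and vanishes for \<open>i = j\<close>, so the double
  sum is exactly twice the sum over \<open>i < j\<close> (lemma \<open>sum_norm_squared_eq\<close>).
  The claim thus compares a finite sum of defects with the sum of their upper bounds \<open>k i j\<close>. Such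
  a comparison holds, and it is an equality precisely when it is an equality term by term.
\<close>

lemma sum_symmetric_square_eq_diagonal_plus_twice:
  fixes f :: "nat \<Rightarrow> nat \<Rightarrow> 'b::comm_semiring_1"
  assumes sym: "\<And>i j. f i j = f j i"
  shows "(\<Sum>i=1..n. \<Sum>j=1..n. f i j)
           = (\<Sum>i=1..n. f i i) + 2 * (\<Sum>(i, j)\<in>{(i, j). 1 \<le> i \<and> i < j \<and> j \<le> n}. f i j)"
proof -
  let ?U = "{(i, j). 1 \<le> i \<and> i < j \<and> j \<le> n}"
  let ?L = "{(i, j). 1 \<le> j \<and> j < i \<and> i \<le> n}"
  let ?D = "(\<lambda>i. (i, i)) ` {1..n}"
  have fin: "finite ?U" "finite ?L" "finite ?D"
    by (rule finite_subset[of _ "{1..n} \<times> {1..n}"]; auto)+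
  have square: "{1..n} \<times> {1..n} = ?D \<union> (?U \<union> ?L)"
    by auto
  have lower: "sum (\<lambda>(i, j). f i j) ?L = sum (\<lambda>(i, j). f i j) ?U"
    by (rule sum.reindex_bij_witness[of _ prod.swap prod.swap]) (auto simp: sym)
  have diagonal: "sum (\<lambda>(i, j). f i j) ?D = (\<Sum>i=1..n. f i i)"
    by (subst sum.reindex) (auto simp: inj_on_def)
  have "(\<Sum>i=1..n. \<Sum>j=1..n. f i j) = sum (\<lambda>(i, j). f i j) (?D \<union> (?U \<union> ?L))"
    by (simp only: sum.cartesian_product square)
  also have "\<dots> = sum (\<lambda>(i, j). f i j) ?D + sum (\<lambda>(i, j). f i j) (?U \<union> ?L)"
    by (rule sum.union_disjoint) (use fin in auto)
  also have "sum (\<lambda>(i, j). f i j) (?U \<union> ?L)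
               = sum (\<lambda>(i, j). f i j) ?U + sum (\<lambda>(i, j). f i j) ?L"
    by (rule sum.union_disjoint) (use fin in auto)
  finally show ?thesis
    unfolding lower diagonal mult_2 .
qed

text \<open>
  Where a sum is maximal under termwise bounds, no summand can have slack, since no negative slack
  is there to compensate for it.
\<close>

lemma sum_eq_sum_iff_of_le:
  fixes f g :: "'b \<Rightarrow> real"
  assumes "finite A" and "\<And>a. a \<in> A \<Longrightarrow> f a \<le> g a"
  shows "sum f A = sum g A \<longleftrightarrow> (\<forall>a\<in>A. f a = g a)"
proof -
  have "sum f A = sum g A \<longleftrightarrow> (\<Sum>a\<in>A. g a - f a) = 0"
    unfolding sum_subtractf by auto
  also have "\<dots> \<longleftrightarrow> (\<forall>a\<in>A. g a - f a = 0)"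
    using assms by (intro sum_nonneg_eq_0_iff) simp_all
  finally show ?thesis
    by auto
qed

context inner_product_space
begin

lemma ip_re_commute: "ip_re ip x y = ip_re ip y x"
  using ip_commute[of x y] by (simp add: ip_re_def)

lemma ip_re_add_left: "ip_re ip (x + y) z = ip_re ip x z + ip_re ip y z"
  by (simp add: ip_re_def ip_add_left to_complex_add)

lemma ip_re_zero_left: "ip_re ip 0 z = 0"
  using ip_re_add_left[of 0 0 z] by simp

lemma ip_re_sum_left: "ip_re ip (sum x A) z = (\<Sum>i\<in>A. ip_re ip (x i) z)"
  by (induction A rule: infinite_finite_induct) (simp_all add: ip_re_zero_left ip_re_add_left)

lemma ip_re_sum_right: "ip_re ip z (sum x A) = (\<Sum>i\<in>A. ip_re ip z (x i))"
  using ip_re_sum_left[of x A z] by (simp add: ip_re_commute)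

lemma ip_norm_squared: "(ip_norm ip x)\<^sup>2 = ip_re ip x x"
  using ip_ge_zero[of x] by (simp add: ip_norm_def ip_re_def)

text \<open>
  The exact form of the inequality: the loss in the triangle inequality, measured with squares, is
  twice the total defect in the Schwarz inequalities for the pairs of vectors.
\<close>

lemma sum_norm_squared_eq:
  fixes x :: "nat \<Rightarrow> 'a"
  shows "(\<Sum>i=1..n. ip_norm ip (x i))\<^sup>2
           = (ip_norm ip (\<Sum>i=1..n. x i))\<^sup>2
             + 2 * (\<Sum>(i, j)\<in>{(i, j). 1 \<le> i \<and> i < j \<and> j \<le> n}.
                      ip_norm ip (x i) * ip_norm ip (x j) - ip_re ip (x i) (x j))"
proof -
  define d where "d i j = ip_norm ip (x i) * ip_norm ip (x j) - ip_re ip (x i) (x j)" for i j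
  have "ip_re ip (\<Sum>i=1..n. x i) (\<Sum>j=1..n. x j) = (\<Sum>i=1..n. \<Sum>j=1..n. ip_re ip (x i) (x j))"
    by (subst ip_re_sum_left, subst ip_re_sum_right) (rule refl)
  then have "(\<Sum>i=1..n. ip_norm ip (x i))\<^sup>2 - (ip_norm ip (\<Sum>i=1..n. x i))\<^sup>2
          = (\<Sum>i=1..n. \<Sum>j=1..n. d i j)"
    unfolding d_def ip_norm_squared sum_subtractf
    by (simp only: power2_eq_square sum_product)
  also have "\<dots> = (\<Sum>i=1..n. d i i) + 2 * (\<Sum>(i, j)\<in>{(i, j). 1 \<le> i \<and> i < j \<and> j \<le> n}. d i j)"
    by (rule sum_symmetric_square_eq_diagonal_plus_twice)
      (simp add: d_def ip_re_commute mult.commute)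
  also have "(\<Sum>i=1..n. d i i) = 0"
    unfolding d_def ip_norm_squared[symmetric] power2_eq_square by simp
  finally show ?thesis
    by (simp add: d_def)
qed

end

theorem lemma1:
  fixes scale :: "'k::real_or_complex \<Rightarrow> 'a::ab_group_add \<Rightarrow> 'a"
    and ip :: "'a \<Rightarrow> 'a \<Rightarrow> 'k"
    and n :: nat
    and x :: "nat \<Rightarrow> 'a"
    and k :: "nat \<Rightarrow> nat \<Rightarrow> real"
  assumes "inner_product_space scale ip"
    and "n \<ge> 1"
    and "\<And>i j. 1 \<le> i \<Longrightarrow> i < j \<Longrightarrow> j \<le> n \<Longrightarrow> k i j > 0"
    and "\<And>i j. 1 \<le> i \<Longrightarrow> i < j \<Longrightarrow> j \<le> n \<Longrightarrow>
           0 \<le> ip_norm ip (x i) * ip_norm ip (x j) - ip_re ip (x i) (x j) \<and>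
           ip_norm ip (x i) * ip_norm ip (x j) - ip_re ip (x i) (x j) \<le> k i j"
  shows "(\<Sum>i=1..n. ip_norm ip (x i))\<^sup>2
           \<le> (ip_norm ip (\<Sum>i=1..n. x i))\<^sup>2
             + 2 * (\<Sum>(i, j)\<in>{(i, j). 1 \<le> i \<and> i < j \<and> j \<le> n}. k i j) \<and>
         ((\<Sum>i=1..n. ip_norm ip (x i))\<^sup>2
           = (ip_norm ip (\<Sum>i=1..n. x i))\<^sup>2
             + 2 * (\<Sum>(i, j)\<in>{(i, j). 1 \<le> i \<and> i < j \<and> j \<le> n}. k i j)
          \<longleftrightarrow>
          (\<forall>i j. 1 \<le> i \<and> i < j \<and> j \<le> n \<longrightarrow>
             ip_norm ip (x i) * ip_norm ip (x j) - ip_re ip (x i) (x j) = k i j))"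
proof -
  interpret inner_product_space scale ip
    by (fact assms(1))
  let ?P = "{(i, j). 1 \<le> i \<and> i < j \<and> j \<le> n}"
  let ?d = "\<lambda>(i, j). ip_norm ip (x i) * ip_norm ip (x j) - ip_re ip (x i) (x j)"
  let ?k = "\<lambda>(i, j). k i j"
  have fin: "finite ?P"
    by (rule finite_subset[of _ "{1..n} \<times> {1..n}"]) auto
  have le: "?d p \<le> ?k p" if "p \<in> ?P" for p
    using that assms(4) by auto
  have "sum ?d ?P \<le> sum ?k ?P"
    by (rule sum_mono) (rule le)
  moreover have "sum ?d ?P = sum ?k ?P \<longleftrightarrow> (\<forall>p\<in>?P. ?d p = ?k p)"
    using fin le by (rule sum_eq_sum_iff_of_le)
  ultimately show ?thesis
    unfolding sum_norm_squared_eq by auto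
qed

end
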